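(* Let $r\ge 1$ and let the function $\boldsymbol f\colon\mathbb R^d\to\mathbb R^p$ be $r$-times differentiable at $\boldsymbol c\in\mathbb R^d$. (i) If $\boldsymbol u\in\mathbb R^d$, then the $r$th order differential of $\boldsymbol f$ at $\boldsymbol c$ with increment $\boldsymbol u$ is given by $$\mathsf d^r\boldsymbol f(\boldsymbol c;\boldsymbol u)=\{\mathbf I_p\otimes(\boldsymbol u^\top)^{\otimes r}\}\,\mathsf D^{\otimes r}\boldsymbol f(\boldsymbol c)=\{\operatorname{vec}^{-1}_{d^r,p}\mathsf D^{\otimes r}\boldsymbol f(\boldsymbol c)\}^\top\boldsymbol u^{\otimes r}.$$ (ii) If $\boldsymbol a\in\mathbb R^{pd^r}$ satisfies $\mathsf d^r\boldsymbol f(\boldsymbol c;\boldsymbol u)=(\operatorname{vec}^{-1}_{d^r,p}\boldsymbol a)^\top\boldsymbol u^{\otimes r}$ for all $\boldsymbol u\in\mathbb R^d$, then $\mathsf D^{\otimes r}\boldsymbol f(\boldsymbol c)=(\mathbf I_p\otimes\boldsymbol{\mathcal S}_{d,r})\boldsymbol a$. If $\mathbf A\in\mathcal M_{d^r\times p}$ satisfies $\mathsf d^r\boldsymbol f(\boldsymbol c;\boldsymbol u)=\mathbf A^\top\boldsymbol u^{\otimes r}$ for all $\boldsymbol u\in\mathbb R^d$, then $\mathsf D^{\otimes r}\boldsymbol f(\boldsymbol c)=(\mathbf I_p\otimes\boldsymbol{\mathcal S}_{d,r})\operatorname{vec}\mathbf A=\operatorname{vec}(\boldsymbol{\mathcal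 S}_{d,r}\mathbf A)$.
   Context: Vectors are column vectors; $\mathcal M_{m\times n}$ is the set of real $m\times n$ matrices; $\mathbf I_p$ is the $p\times p$ identity; $\otimes$ is the Kronecker product, and $\boldsymbol A^{\otimes r}$ the $r$-fold Kronecker power ($\boldsymbol A^{\otimes 1}=\boldsymbol A$, $\boldsymbol A^{\otimes 0}=1$). $\operatorname{vec}$ stacks the columns of a matrix underneath each other, and $\operatorname{vec}^{-1}_{m,n}\colon\mathbb R^{mn}\to\mathcal M_{m\times n}$ is the inverse of the isomorphism $\operatorname{vec}\colon\mathcal M_{m\times n}\to\mathbb R^{mn}$. Differentiability: a real function $f$ on $\mathbb R^d$ is once differentiable at $\boldsymbol c$ in the usual (Fréchet) sense; for $r>1$, it is $r$ times differentiable at $\boldsymbol c$ if it is $(r-1)$ times differentiable in a neighborhood of $\boldsymbol c$ and all its partial derivatives of order $r-1$ are differentiable at $\boldsymbol c$. A vector-valued function is $r$ times differentiable if all its components are. For scalar $f$, $\mathsf d^r f(\boldsymbol c;\boldsymbol u)=\sum_{i_1,\dots,i_r=1}^d u_{i_1}\cdots u_{i_r}\,\frac{\partial^r f}{\partial x_{i_1}\cdots\partial x_{i_r}}(\boldsymbol c)$, and $\mathsf D^{\otimes r}f(\boldsymbol c)\in\mathbb R^{d^r}$ is the vector whose entry at position $1+\sum_{j=1}^r(i_j-1)d^{r-j}$ is $\frac{\partial^r f}{\partial x_{i_1}\cdots\partial x_{i_r}}(\boldsymbol c)$. For $\boldsymbol f=(f_1,\dots,f_p)$, $\mathsf d^r\boldsymbol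 f(\boldsymbol c;\boldsymbol u)=(\mathsf d^rf_1(\boldsymbol c;\boldsymbol u),\dots,\mathsf d^rf_p(\boldsymbol c;\boldsymbol u))\in\mathbb R^p$, and $\mathsf D^{\otimes r}\boldsymbol f(\boldsymbol c)\in\mathbb R^{pd^r}$ is obtained by stacking $\mathsf D^{\otimes r}f_1(\boldsymbol c),\dots,\mathsf D^{\otimes r}f_p(\boldsymbol c)$ underneath each other. Symmetrizer matrix: $\boldsymbol{\mathcal S}_{d,r}$ is the $d^r\times d^r$ matrix determined by $r!\,\boldsymbol{\mathcal S}_{d,r}(\boldsymbol v_1\otimes\cdots\otimes\boldsymbol v_r)=\sum_{\sigma\in\mathcal P_r}\boldsymbol v_{\sigma(1)}\otimes\cdots\otimes\boldsymbol v_{\sigma(r)}$ for all $\boldsymbol v_1,\dots,\boldsymbol v_r\in\mathbb R^d$, where $\mathcal P_r$ is the set of all permutations of $\{1,\dots,r\}$. *)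

theory Defs
  imports
    "HOL-Analysis.Analysis"
    "HOL-Combinatorics.Permutations"
    "Jordan_Normal_Form.Matrix"
begin

hide_const (open) Finite_Cartesian_Product.vec
hide_type (open) Finite_Cartesian_Product.vec
no_notation vec_nth (infixl \<open>$\<close> 90)

text \<open>
  Functions live on the normed spaces \<^typ>\<open>real^'d\<close>, so that differentiability is the library notion.
  The objects whose size is \<open>d ^ r\<close> or \<open>p * d ^ r\<close>, with \<open>d = CARD('d)\<close> and \<open>p = CARD('p)\<close>, are vectors
  and matrices with explicit dimensions.  The order on the index type fixes which coordinate is the
  first, the second, and so on.  All positions count from \<open>0\<close>.
\<close>

section \<open>Coordinates\<close>

definition coord_pos :: "'n::{finite,linorder} \<Rightarrow> nat" where
  "coord_pos i = card {..<i}"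

definition nth_coord :: "nat \<Rightarrow> 'n::{finite,linorder}" where
  "nth_coord = the_inv coord_pos"

definition coord_vec :: "real^'n::{finite,linorder} \<Rightarrow> real vec" where
  "coord_vec x = vec CARD('n) (\<lambda>k. vec_nth x (nth_coord k))"

lemma coord_pos_bij: "bij_betw (coord_pos :: 'n \<Rightarrow> nat) UNIV {..<CARD('n::{finite,linorder})}"
proof -
  have mono: "coord_pos i < coord_pos j" if "i < j" for i j :: 'n
    unfolding coord_pos_def using that by (intro psubset_card_mono) auto
  have inj: "inj (coord_pos :: 'n \<Rightarrow> nat)"
    by (metis injI mono less_irrefl linorder_neqE)
  moreover have sub: "range (coord_pos :: 'n \<Rightarrow> nat) \<subseteq> {..<CARD('n)}"
    by (auto simp: coord_pos_def intro!: psubset_card_mono)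
  moreover have "range (coord_pos :: 'n \<Rightarrow> nat) = {..<CARD('n)}"
    using sub inj by (intro card_subset_eq) (auto simp: card_image)
  ultimately show ?thesis by (simp add: bij_betw_def)
qed

lemma nth_coord_coord_pos [simp]: "nth_coord (coord_pos i) = (i :: 'n::{finite,linorder})"
  unfolding nth_coord_def using coord_pos_bij by (metis bij_betw_def the_inv_f_f)

lemma coord_pos_nth_coord [simp]:
  "k < CARD('n) \<Longrightarrow> coord_pos (nth_coord k :: 'n::{finite,linorder}) = k"
  by (metis coord_pos_bij bij_betw_def imageE lessThan_iff nth_coord_coord_pos)

lemma coord_pos_less [simp]: "coord_pos (i :: 'n) < CARD('n::{finite,linorder})"
  using coord_pos_bij by (metis bij_betw_def lessThan_iff rangeI)

lemma coord_vec_carrier [simp]: "coord_vec (x :: real^'n::{finite,linorder}) \<in> carrier_vec CARD('n)"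
  by (simp add: coord_vec_def)

lemma coord_vec_index [simp]:
  "coord_vec x $ coord_pos i = vec_nth x (i :: 'n::{finite,linorder})"
  by (simp add: coord_vec_def)


section \<open>Vectorization and Kronecker products\<close>

definition vec_of_mat :: "'a mat \<Rightarrow> 'a vec" where
  "vec_of_mat A = vec (dim_row A * dim_col A) (\<lambda>k. A $$ (k mod dim_row A, k div dim_row A))"

definition mat_of_vec :: "nat \<Rightarrow> nat \<Rightarrow> 'a vec \<Rightarrow> 'a mat" where
  "mat_of_vec m n = the_inv_into (carrier_mat m n) vec_of_mat"

definition kron_mat :: "'a::times mat \<Rightarrow> 'a mat \<Rightarrow> 'a mat" where
  "kron_mat A B = mat (dim_row A * dim_row B) (dim_col A * dim_col B)
     (\<lambda>(i, j). A $$ (i div dim_row B, j div dim_col B) * B $$ (i mod dim_row B, j mod dim_col B))"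

primrec kron_mat_pow :: "'a::{zero,one,times} mat \<Rightarrow> nat \<Rightarrow> 'a mat" where
  "kron_mat_pow A 0 = 1\<^sub>m 1"
| "kron_mat_pow A (Suc r) = kron_mat A (kron_mat_pow A r)"

text \<open>The Kronecker product of column vectors; see \<open>mat_of_cols_kron_vec\<close> below.\<close>

definition kron_vec :: "'a::times vec \<Rightarrow> 'a vec \<Rightarrow> 'a vec" where
  "kron_vec v w = vec (dim_vec v * dim_vec w) (\<lambda>k. v $ (k div dim_vec w) * w $ (k mod dim_vec w))"

definition kron_vec_list :: "'a::{one,times} vec list \<Rightarrow> 'a vec" where
  "kron_vec_list vs = foldr kron_vec vs (vec 1 (\<lambda>_. 1))"

definition kron_vec_pow :: "'a::{one,times} vec \<Rightarrow> nat \<Rightarrow> 'a vec" where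
  "kron_vec_pow v r = kron_vec_list (replicate r v)"

text \<open>
  The position of an index tuple, given by its list of (0-based) entries, in lexicographic order:
  the 0-based form of \<open>1 + (\<Sum>j=1..r. (i\<^sub>j - 1) * d ^ (r - j))\<close>.
\<close>

definition digit_pos :: "nat \<Rightarrow> nat list \<Rightarrow> nat" where
  "digit_pos d ns = (\<Sum>j<length ns. ns ! j * d ^ (length ns - 1 - j))"

lemma vec_of_mat_carrier: "A \<in> carrier_mat m n \<Longrightarrow> vec_of_mat A \<in> carrier_vec (m * n)"
  by (auto simp: vec_of_mat_def)

lemma pair_index_less: "i < m \<Longrightarrow> j < n \<Longrightarrow> j * m + i < m * (n::nat)"
proof -
  assume "i < m" "j < n"
  then have "j * m + i < Suc j * m" "Suc j * m \<le> n * m" by (simp, intro mult_right_mono) auto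
  then show ?thesis by (simp add: mult.commute)
qed

lemma pair_index_div: "i < m \<Longrightarrow> (j * m + i) div m = (j::nat)"
  by (cases "m = 0") auto

lemma vec_of_mat_index:
  assumes "A \<in> carrier_mat m n" "i < m" "j < n"
  shows "vec_of_mat A $ (j * m + i) = A $$ (i, j)"
  using assms pair_index_less[OF assms(2,3)] by (auto simp: vec_of_mat_def)

lemma inj_on_vec_of_mat: "inj_on vec_of_mat (carrier_mat m n)"
  by (intro inj_onI eq_matI) (auto simp flip: vec_of_mat_index[where m = m and n = n])

lemma mat_of_vec_vec_of_mat:
  "A \<in> carrier_mat m n \<Longrightarrow> mat_of_vec m n (vec_of_mat A) = A"
  unfolding mat_of_vec_def by (rule the_inv_into_f_f[OF inj_on_vec_of_mat])

lemma mat_of_vec_eq: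
  assumes "a \<in> carrier_vec (m * n)"
  shows "mat_of_vec m n a = mat m n (\<lambda>(i, j). a $ (j * m + i))"
proof -
  have "vec_of_mat (mat m n (\<lambda>(i, j). a $ (j * m + i))) = a"
  proof (rule eq_vecI)
    fix k assume "k < dim_vec a"
    then have k: "k < m * n" using assms by simp
    then have "k mod m < m" "k div m < n"
      by (cases "m = 0"; simp add: less_mult_imp_div_less mult.commute)+
    then show "vec_of_mat (mat m n (\<lambda>(i, j). a $ (j * m + i))) $ k = a $ k"
      using k by (simp add: vec_of_mat_def)
  qed (use assms in \<open>simp add: vec_of_mat_def\<close>)
  then show ?thesis
    by (metis mat_of_vec_vec_of_mat mat_carrier)
qed

lemma vec_of_mat_mat_of_vec:
  assumes "a \<in> carrier_vec (m * n)"
  shows "mat_of_vec m n a \<in> carrier_mat m n" "vec_of_mat (mat_of_vec m n a) = a"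
proof -
  show 1: "mat_of_vec m n a \<in> carrier_mat m n"
    by (simp add: mat_of_vec_eq[OF assms])
  show "vec_of_mat (mat_of_vec m n a) = a"
  proof (rule eq_vecI)
    fix k assume "k < dim_vec a"
    then have k: "k < m * n" using assms by simp
    then have "k mod m < m" "k div m < n"
      by (cases "m = 0"; simp add: less_mult_imp_div_less mult.commute)+
    then show "vec_of_mat (mat_of_vec m n a) $ k = a $ k"
      using k by (simp add: vec_of_mat_def mat_of_vec_eq[OF assms])
  qed (use assms in \<open>simp add: vec_of_mat_def mat_of_vec_eq[OF assms]\<close>)
qed

lemma mat_of_cols_kron_vec:
  "mat_of_cols (dim_vec v * dim_vec w) [kron_vec v w] =
   kron_mat (mat_of_cols (dim_vec v) [v]) (mat_of_cols (dim_vec w) [w])"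
proof (rule eq_matI)
  fix i j
  assume "i < dim_row (kron_mat (mat_of_cols (dim_vec v) [v]) (mat_of_cols (dim_vec w) [w]))"
    and "j < dim_col (kron_mat (mat_of_cols (dim_vec v) [v]) (mat_of_cols (dim_vec w) [w]))"
  then have ij: "i < dim_vec v * dim_vec w" "j = 0" by (auto simp: kron_mat_def)
  then have "i mod dim_vec w < dim_vec w" "i div dim_vec w < dim_vec v"
    by (cases "dim_vec w = 0"; simp add: less_mult_imp_div_less)+
  with ij show "mat_of_cols (dim_vec v * dim_vec w) [kron_vec v w] $$ (i, j) =
    kron_mat (mat_of_cols (dim_vec v) [v]) (mat_of_cols (dim_vec w) [w]) $$ (i, j)"
    by (simp add: kron_mat_def kron_vec_def mat_of_cols_def)
qed (auto simp: kron_mat_def)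

lemma digit_pos_Nil [simp]: "digit_pos d [] = 0"
  by (simp add: digit_pos_def)

lemma digit_pos_Cons [simp]: "digit_pos d (n # ns) = n * d ^ length ns + digit_pos d ns"
  unfolding digit_pos_def by (simp add: sum.lessThan_Suc_shift del: sum.lessThan_Suc)

lemma digit_pos_less: "set ns \<subseteq> {..<d} \<Longrightarrow> digit_pos d ns < d ^ length ns"
proof (induction ns)
  case (Cons n ns)
  then have "digit_pos d ns < d ^ length ns" "n < d" by auto
  then show ?case using pair_index_less[of "digit_pos d ns" "d ^ length ns" n d]
    by (simp add: mult.commute)
qed simp

lemma digit_pos_inj:
  "length ms = length ns \<Longrightarrow> set ms \<subseteq> {..<d} \<Longrightarrow> set ns \<subseteq> {..<d} \<Longrightarrow>
   digit_pos d ms = digit_pos d ns \<Longrightarrow> ms = ns"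
proof (induction ms ns rule: list_induct2)
  case (Cons m ms n ns)
  have l: "digit_pos d ms < d ^ length ms" "digit_pos d ns < d ^ length ms"
    using Cons digit_pos_less[of ms d] digit_pos_less[of ns d] by auto
  have eq: "m * d ^ length ms + digit_pos d ms = n * d ^ length ms + digit_pos d ns"
    using Cons by simp
  have "m = n" using arg_cong[OF eq, of "\<lambda>x. x div d ^ length ms"] l by (simp only: pair_index_div)
  with eq Cons show ?case by simp
qed simp

lemma digit_pos_bij:
  "bij_betw (digit_pos d) {ns. length ns = r \<and> set ns \<subseteq> {..<d}} {..<d ^ r}"
proof -
  let ?T = "{ns. length ns = r \<and> set ns \<subseteq> {..<d}}"
  have T: "?T = {ns. set ns \<subseteq> {..<d} \<and> length ns = r}" by auto
  have inj: "inj_on (digit_pos d) ?T" by (auto intro!: inj_onI digit_pos_inj)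
  moreover have sub: "digit_pos d ` ?T \<subseteq> {..<d ^ r}" using digit_pos_less by auto
  moreover have "card ?T = d ^ r"
    unfolding T by (simp add: card_lists_length_eq)
  ultimately have "digit_pos d ` ?T = {..<d ^ r}"
    by (intro card_subset_eq) (auto simp: card_image)
  with inj show ?thesis by (simp add: bij_betw_def)
qed

lemma ex_digit_pos:
  assumes "k < d ^ r"
  obtains ns where "length ns = r" "set ns \<subseteq> {..<d}" "k = digit_pos d ns"
proof -
  from assms have "k \<in> digit_pos d ` {ns. length ns = r \<and> set ns \<subseteq> {..<d}}"
    using digit_pos_bij[of d r] by (simp add: bij_betw_def)
  then show ?thesis using that by blast
qed

lemma kron_vec_list_carrier: "set vs \<subseteq> carrier_vec d \<Longrightarrow> kron_vec_list vs \<in> carrier_vec (d ^ length vs)"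
  by (induction vs) (auto simp: kron_vec_list_def kron_vec_def)

lemma kron_vec_list_index:
  "length vs = length ns \<Longrightarrow> set vs \<subseteq> carrier_vec d \<Longrightarrow> set ns \<subseteq> {..<d} \<Longrightarrow>
   kron_vec_list vs $ digit_pos d ns = (\<Prod>j<length ns. vs ! j $ (ns ! j) :: real)"
proof (induction vs ns rule: list_induct2)
  case (Cons v vs n ns)
  have w: "kron_vec_list vs \<in> carrier_vec (d ^ length ns)"
    using kron_vec_list_carrier[of vs d] Cons by simp
  have v: "dim_vec v = d" using Cons.prems by auto
  have l: "digit_pos d ns < d ^ length ns" "n < d"
    using Cons digit_pos_less[of ns d] by auto
  have "n * d ^ length ns + digit_pos d ns < d * d ^ length ns"
    using pair_index_less[OF l] by (simp add: mult.commute)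
  then have "kron_vec_list (v # vs) $ digit_pos d (n # ns) = v $ n * kron_vec_list vs $ digit_pos d ns"
    using w l v pair_index_div[OF l(1), of n] by (simp add: kron_vec_list_def kron_vec_def)
  with Cons show ?case by (simp add: prod.lessThan_Suc_shift del: prod.lessThan_Suc)
qed (simp add: kron_vec_list_def)


section \<open>The symmetrizer matrix\<close>

definition is_symmetrizer :: "nat \<Rightarrow> nat \<Rightarrow> real mat \<Rightarrow> bool" where
  "is_symmetrizer d r S \<longleftrightarrow> S \<in> carrier_mat (d ^ r) (d ^ r) \<and>
     (\<forall>vs. length vs = r \<and> set vs \<subseteq> carrier_vec d \<longrightarrow>
        fact r \<cdot>\<^sub>v (S *\<^sub>v kron_vec_list vs) =
        finsum_vec TYPE(real) (d ^ r) (\<lambda>\<sigma>. kron_vec_list (permute_list \<sigma> vs)) {\<sigma>. \<sigma> permutes {..<r}})"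

definition symmetrizer :: "nat \<Rightarrow> nat \<Rightarrow> real mat" where
  "symmetrizer d r = (THE S. is_symmetrizer d r S)"

lemma ex_symmetrizer: "\<exists>S. is_symmetrizer d r S"
proof -
  define T where "T = {ns. length ns = r \<and> set ns \<subseteq> {..<d}}"
  define dec where "dec = the_inv_into T (digit_pos d)"
  define P where "P = {\<sigma>. \<sigma> permutes {..<r}}"
  define q where "q \<sigma> k = digit_pos d (permute_list (inv_into UNIV \<sigma>) (dec k))" for \<sigma> k
  define S where "S = mat (d ^ r) (d ^ r) (\<lambda>(k, l). (\<Sum>\<sigma>\<in>P. if l = q \<sigma> k then 1 else 0) / fact r :: real)"
  have bij: "bij_betw (digit_pos d) T {..<d ^ r}" unfolding T_def by (rule digit_pos_bij)
  have dec: "dec k \<in> T" "digit_pos d (dec k) = k" if "k < d ^ r" for k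
    using bij that unfolding dec_def bij_betw_def
    by (metis lessThan_iff order_refl the_inv_into_into, metis f_the_inv_into_f lessThan_iff)
  have perm: "permute_list \<tau> ns \<in> T" if "\<tau> permutes {..<r}" "ns \<in> T" for \<tau> ns
    using that by (auto simp: T_def)
  have q: "q \<sigma> k < d ^ r" if "\<sigma> \<in> P" "k < d ^ r" for \<sigma> k
    using perm[OF permutes_inv dec(1)[OF that(2)]] that bij
    by (auto simp: q_def P_def bij_betw_def)
  have finP: "finite P" by (simp add: P_def finite_permutations)
  have "fact r \<cdot>\<^sub>v (S *\<^sub>v kron_vec_list vs) =
        finsum_vec TYPE(real) (d ^ r) (\<lambda>\<sigma>. kron_vec_list (permute_list \<sigma> vs)) P"
    if vs: "length vs = r" "set vs \<subseteq> carrier_vec d" for vs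
  proof -
    have pv: "kron_vec_list (permute_list \<sigma> vs) \<in> carrier_vec (d ^ r)" if "\<sigma> \<in> P" for \<sigma>
      using kron_vec_list_carrier[of "permute_list \<sigma> vs" d] that vs by (simp add: P_def)
    have w: "kron_vec_list vs \<in> carrier_vec (d ^ r)"
      using kron_vec_list_carrier[of vs d] vs by simp
    show ?thesis
    proof (rule eq_vecI)
      have fc: "finsum_vec TYPE(real) (d ^ r) (\<lambda>\<sigma>. kron_vec_list (permute_list \<sigma> vs)) P
                \<in> carrier_vec (d ^ r)"
        using pv by (intro finsum_vec_closed) auto
      show "dim_vec (fact r \<cdot>\<^sub>v (S *\<^sub>v kron_vec_list vs)) =
        dim_vec (finsum_vec TYPE(real) (d ^ r) (\<lambda>\<sigma>. kron_vec_list (permute_list \<sigma> vs)) P)"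
        using fc by (simp add: S_def)
      fix k assume "k < dim_vec (finsum_vec TYPE(real) (d ^ r)
        (\<lambda>\<sigma>. kron_vec_list (permute_list \<sigma> vs)) P)"
      then have k: "k < d ^ r" using fc by simp
      have lk: "length (dec k) = r" "set (dec k) \<subseteq> {..<d}" using dec(1)[OF k] by (auto simp: T_def)
      have "(fact r \<cdot>\<^sub>v (S *\<^sub>v kron_vec_list vs)) $ k =
            (\<Sum>l<d ^ r. (\<Sum>\<sigma>\<in>P. if l = q \<sigma> k then 1 else 0) * kron_vec_list vs $ l)"
        using k w by (simp add: S_def scalar_prod_def sum_distrib_left atLeast0LessThan)
      also have "\<dots> = (\<Sum>\<sigma>\<in>P. \<Sum>l<d ^ r. if l = q \<sigma> k then kron_vec_list vs $ l else 0)"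
        unfolding sum_distrib_right by (subst sum.swap) (intro sum.cong; simp)
      also have "\<dots> = (\<Sum>\<sigma>\<in>P. kron_vec_list vs $ q \<sigma> k)"
        using q[OF _ k] by (intro sum.cong) auto
      also have "\<dots> = (\<Sum>\<sigma>\<in>P. kron_vec_list (permute_list \<sigma> vs) $ k)"
      proof (rule sum.cong[OF refl])
        fix \<sigma> assume "\<sigma> \<in> P"
        then have \<sigma>: "\<sigma> permutes {..<r}" by (simp add: P_def)
        note i = permutes_inv[OF \<sigma>]
        have "kron_vec_list vs $ q \<sigma> k = (\<Prod>j<r. vs ! j $ (dec k ! (inv_into UNIV \<sigma> j)))"
          unfolding q_def using vs lk i
          by (subst kron_vec_list_index) (auto intro!: prod.cong simp: permute_list_nth)
        also have "\<dots> = (\<Prod>j<r. vs ! \<sigma> j $ (dec k ! j))"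
          by (subst prod.permute[OF \<sigma>]) (simp add: permutes_inverses[OF \<sigma>])
        also have "\<dots> = kron_vec_list (permute_list \<sigma> vs) $ digit_pos d (dec k)"
          using vs lk \<sigma>
          by (subst kron_vec_list_index) (auto intro!: prod.cong simp: permute_list_nth)
        finally show "kron_vec_list vs $ q \<sigma> k = kron_vec_list (permute_list \<sigma> vs) $ k"
          by (simp add: dec(2)[OF k])
      qed
      also have "\<dots> = finsum_vec TYPE(real) (d ^ r) (\<lambda>\<sigma>. kron_vec_list (permute_list \<sigma> vs)) P $ k"
        using pv by (subst index_finsum_vec[OF finP k]) auto
      finally show "(fact r \<cdot>\<^sub>v (S *\<^sub>v kron_vec_list vs)) $ k =
        finsum_vec TYPE(real) (d ^ r) (\<lambda>\<sigma>. kron_vec_list (permute_list \<sigma> vs)) P $ k" .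
    qed
  qed
  then have "is_symmetrizer d r S"
    unfolding is_symmetrizer_def P_def by (simp add: S_def)
  then show ?thesis by blast
qed

lemma unit_vec_digit_pos:
  assumes "set ns \<subseteq> {..<d}"
  shows "(unit_vec (d ^ length ns) (digit_pos d ns) :: real vec) = kron_vec_list (map (unit_vec d) ns)"
proof (rule eq_vecI)
  let ?us = "map (unit_vec d) ns :: real vec list"
  have us: "length ?us = length ns" "set ?us \<subseteq> carrier_vec d" by auto
  have c: "kron_vec_list ?us \<in> carrier_vec (d ^ length ns)"
    using kron_vec_list_carrier[OF us(2)] by simp
  then show "dim_vec (unit_vec (d ^ length ns) (digit_pos d ns)) = dim_vec (kron_vec_list ?us)"
    by simp
  fix k assume "k < dim_vec (kron_vec_list ?us)"
  then have k: "k < d ^ length ns" using c by simp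
  then obtain ms where ms: "length ms = length ns" "set ms \<subseteq> {..<d}" "k = digit_pos d ms"
    by (rule ex_digit_pos)
  have mn: "ms ! j < d" "ns ! j < d" if "j < length ns" for j
    using that ms(1,2) assms subsetD[OF ms(2) nth_mem[of j ms]] subsetD[OF assms nth_mem[of j ns]]
    by auto
  have "kron_vec_list ?us $ k = (\<Prod>j<length ns. if ms ! j = ns ! j then 1 else 0)"
    using ms us(2) mn by (simp add: kron_vec_list_index)
  also have "\<dots> = (if ms = ns then 1 else 0)"
    using ms(1) by (auto simp: list_eq_iff_nth_eq)
  also have "\<dots> = unit_vec (d ^ length ns) (digit_pos d ns) $ k"
    using k ms digit_pos_inj[OF ms(1,2) assms] digit_pos_less[OF assms] by auto
  finally show "unit_vec (d ^ length ns) (digit_pos d ns) $ k = kron_vec_list ?us $ k" by simp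
qed

lemma symmetrizer_unique:
  assumes "is_symmetrizer d r S" "is_symmetrizer d r S'"
  shows "S = S'"
proof (rule mat_col_eqI)
  have c: "S \<in> carrier_mat (d ^ r) (d ^ r)" "S' \<in> carrier_mat (d ^ r) (d ^ r)"
    using assms by (auto simp: is_symmetrizer_def)
  then show "dim_row S = dim_row S'" "dim_col S = dim_col S'" by auto
  fix l assume "l < dim_col S'"
  then have l: "l < d ^ r" using c by simp
  then obtain ns where ns: "length ns = r" "set ns \<subseteq> {..<d}" "l = digit_pos d ns"
    by (rule ex_digit_pos)
  let ?us = "map (unit_vec d) ns :: real vec list"
  have us: "length ?us = r" "set ?us \<subseteq> carrier_vec d" using ns by auto
  have "fact r \<cdot>\<^sub>v (S *\<^sub>v kron_vec_list ?us) = fact r \<cdot>\<^sub>v (S' *\<^sub>v kron_vec_list ?us)"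
    using assms us unfolding is_symmetrizer_def by metis
  then have "inverse (fact r) \<cdot>\<^sub>v (fact r \<cdot>\<^sub>v (S *\<^sub>v kron_vec_list ?us)) =
             inverse (fact r) \<cdot>\<^sub>v (fact r \<cdot>\<^sub>v (S' *\<^sub>v kron_vec_list ?us))"
    by simp
  then have "S *\<^sub>v kron_vec_list ?us = S' *\<^sub>v kron_vec_list ?us"
    by (simp add: smult_smult_assoc)
  moreover have "kron_vec_list ?us = unit_vec (d ^ r) l"
    using unit_vec_digit_pos[OF ns(2)] ns by simp
  moreover have "M *\<^sub>v unit_vec (d ^ r) l = col M l" if "M \<in> carrier_mat (d ^ r) (d ^ r)" for M :: "real mat"
    using that l by (intro eq_vecI) (auto simp: scalar_prod_right_unit)
  ultimately show "col S l = col S' l"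
    using c by simp
qed

lemma is_symmetrizer_symmetrizer: "is_symmetrizer d r (symmetrizer d r)"
  unfolding symmetrizer_def by (rule theI') (use ex_symmetrizer symmetrizer_unique in blast)


section \<open>Higher order derivatives\<close>

definition partial_deriv :: "'d \<Rightarrow> (real^'d \<Rightarrow> real) \<Rightarrow> real^'d \<Rightarrow> real" where
  "partial_deriv i f x = deriv (\<lambda>t. f (x + t *\<^sub>R axis i 1)) 0"

primrec iter_partial_deriv :: "'d list \<Rightarrow> (real^'d \<Rightarrow> real) \<Rightarrow> real^'d \<Rightarrow> real" where
  "iter_partial_deriv [] f = f"
| "iter_partial_deriv (i # js) f = partial_deriv i (iter_partial_deriv js f)"

text \<open>
  With no condition for \<open>r = 0\<close>, the successor equation specializes to plain differentiability at \<open>c\<close>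
  for \<open>r = 1\<close>.
\<close>

primrec times_differentiable_at :: "nat \<Rightarrow> (real^'d \<Rightarrow> real) \<Rightarrow> real^'d \<Rightarrow> bool" where
  "times_differentiable_at 0 f c \<longleftrightarrow> True"
| "times_differentiable_at (Suc r) f c \<longleftrightarrow>
     (\<forall>\<^sub>F x in nhds c. times_differentiable_at r f x) \<and>
     (\<forall>js. length js = r \<longrightarrow> iter_partial_deriv js f differentiable (at c))"

lemma times_differentiable_at_1: "times_differentiable_at 1 f c \<longleftrightarrow> f differentiable (at c)"
  by simp

definition vec_times_differentiable_at :: "nat \<Rightarrow> (real^'d \<Rightarrow> real^'p) \<Rightarrow> real^'d \<Rightarrow> bool" where
  "vec_times_differentiable_at r f c \<longleftrightarrow> (\<forall>k. times_differentiable_at r (\<lambda>x. vec_nth (f x) k) c)"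

definition differential :: "nat \<Rightarrow> (real^'d \<Rightarrow> real) \<Rightarrow> real^'d \<Rightarrow> real^'d \<Rightarrow> real" where
  "differential r f c u =
     (\<Sum>js | length js = r. prod_list (map (vec_nth u) js) * iter_partial_deriv js f c)"

definition vec_differential :: "nat \<Rightarrow> (real^'d \<Rightarrow> real^'p) \<Rightarrow> real^'d \<Rightarrow> real^'d \<Rightarrow> real^'p" where
  "vec_differential r f c u = (\<chi> k. differential r (\<lambda>x. vec_nth (f x) k) c u)"

definition tuple_pos :: "'d::{finite,linorder} list \<Rightarrow> nat" where
  "tuple_pos js = digit_pos CARD('d) (map coord_pos js)"

definition deriv_vec :: "nat \<Rightarrow> (real^'d::{finite,linorder} \<Rightarrow> real) \<Rightarrow>
    real^'d::{finite,linorder} \<Rightarrow> real vec" where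
  "deriv_vec r f c =
     vec (CARD('d) ^ r) (\<lambda>k. iter_partial_deriv (the_inv_into {js. length js = r} tuple_pos k) f c)"

text \<open>Block \<open>k\<close>, of length \<open>d ^ r\<close>, is the derivative vector of the \<open>k\<close>-th component.\<close>

definition vec_deriv_vec ::
  "nat \<Rightarrow> (real^'d::{finite,linorder} \<Rightarrow> real^'p::{finite,linorder}) \<Rightarrow>
    real^'d::{finite,linorder} \<Rightarrow> real vec" where
  "vec_deriv_vec r f c = vec (CARD('p) * CARD('d) ^ r)
     (\<lambda>k. deriv_vec r (\<lambda>x. vec_nth (f x) (nth_coord (k div CARD('d) ^ r))) c $ (k mod CARD('d) ^ r))"

lemma tuple_pos_bij:
  "bij_betw (tuple_pos :: 'd list \<Rightarrow> nat) {js. length js = r} {..<CARD('d::{finite,linorder}) ^ r}"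
proof -
  have "bij_betw (map (coord_pos :: 'd \<Rightarrow> nat)) {js. length js = r}
        {ns. length ns = r \<and> set ns \<subseteq> {..<CARD('d)}}"
  proof (rule bij_betw_byWitness[where f' = "map nth_coord"])
    show "\<forall>ns\<in>{ns. length ns = r \<and> set ns \<subseteq> {..<CARD('d)}}.
      map coord_pos (map (nth_coord :: nat \<Rightarrow> 'd) ns) = ns"
      by (auto intro!: map_idI)
  qed (auto simp: comp_def)
  from bij_betw_trans[OF this digit_pos_bij] show ?thesis
    by (simp add: comp_def tuple_pos_def[abs_def])
qed

lemma deriv_vec_index:
  fixes js :: "'d::{finite,linorder} list"
  assumes "length js = r"
  shows "deriv_vec r f c $ tuple_pos js = iter_partial_deriv js f c"
proof -
  have b: "bij_betw (tuple_pos :: 'd list \<Rightarrow> nat) {js. length js = r} {..<CARD('d) ^ r}"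
    by (rule tuple_pos_bij)
  then have "tuple_pos js < CARD('d) ^ r" using assms by (auto simp: bij_betw_def)
  moreover have "the_inv_into {js. length js = r} tuple_pos (tuple_pos js) = js"
    using b assms by (intro the_inv_into_f_f) (auto simp: bij_betw_def)
  ultimately show ?thesis by (simp add: deriv_vec_def)
qed

end

theory Submission
  imports Defs
begin

text \<open>
  The components are independent, so consider one scalar function \<open>g\<close>.  Write \<open>b js\<close> for an entry of a vector
  of length \<open>d ^ r\<close>, indexed by the tuples \<open>js\<close> of \<open>r\<close> coordinates; pairing the vector with the
  Kronecker power of \<open>u\<close> gives the form \<open>u \<mapsto> \<Sum>js. u(js\<^sub>1) \<cdots> u(js\<^sub>r) * b js\<close>, and the differential is the
  form of the derivative vector.  This is the formula for the differential.

  For the recovery of the derivative vector, a form does not determine its coefficients, because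
  \<open>u(js\<^sub>1) \<cdots> u(js\<^sub>r)\<close> ignores the order of \<open>js\<close>; it determines exactly their sums over the permutations of a tuple.  This is
  polarization (\<open>sum_permutations_eq_0_if_form_eq_0\<close>).  The symmetrizer replaces each entry by the mean
  over these permutations (\<open>symmetrizer_mult_vec_index\<close>), so two vectors with the same form have the same
  image under it.  It remains that the derivative vector is fixed by the symmetrizer, that is, that
  the partial derivatives of order \<open>r\<close> do not depend on the order of differentiation
  (\<open>iter_partial_deriv_mset\<close>).  Since the derivatives of top order need not be continuous, or even
  exist away from \<open>c\<close>, this is Young's form of the symmetry theorem (\<open>partial_deriv_commute\<close>): two
  partial derivatives commute at a point at which the first-order partial derivatives are
  differentiable, if the function is differentiable nearby.  The two outermost operators commute by
  Young's theorem, and operators further inside can be rearranged because lower orders are already symmetric in a neighborhood of the point.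

  The passage to \<open>p\<close> components is the identity \<open>vec (M A) = (I \<otimes> M) vec A\<close>
  (\<open>kron_mat_one_mult_vec_of_mat\<close>), applied with a row vector as \<open>M\<close> for the differential and with the
  symmetrizer for the derivative vector.
\<close>

section \<open>Symmetry of higher partial derivatives\<close>

lemma has_real_derivative_along_axis:
  fixes g :: "real^'d \<Rightarrow> real"
  assumes "(g has_derivative L) (at (x + s *\<^sub>R axis i 1))"
  shows "((\<lambda>t. g (x + t *\<^sub>R axis i 1)) has_real_derivative L (axis i 1)) (at s)"
proof -
  have "((\<lambda>t. x + t *\<^sub>R axis i 1) has_derivative (\<lambda>t. t *\<^sub>R axis i 1)) (at s)"
    by (auto intro!: derivative_eq_intros)
  from has_derivative_compose[OF this assms] show ?thesis
    using linear_scale[OF has_derivative_linear[OF assms]]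
    by (simp add: has_field_derivative_def mult_commute_abs)
qed

lemma partial_deriv_eq_frechet:
  fixes g :: "real^'d \<Rightarrow> real"
  assumes "(g has_derivative L) (at c)"
  shows "partial_deriv i g c = L (axis i 1)"
  unfolding partial_deriv_def using assms
  by (intro DERIV_imp_deriv has_real_derivative_along_axis) simp

lemma has_real_derivative_partial:
  fixes g :: "real^'d \<Rightarrow> real"
  assumes "g differentiable (at (x + s *\<^sub>R axis i 1))"
  shows "((\<lambda>t. g (x + t *\<^sub>R axis i 1)) has_real_derivative
            partial_deriv i g (x + s *\<^sub>R axis i 1)) (at s)"
  using assms unfolding differentiable_def
  by (metis has_real_derivative_along_axis partial_deriv_eq_frechet)

text \<open>
  The mean value theorem in direction \<open>i\<close>, for \<open>s \<mapsto> g (c + s e\<^sub>i + t e\<^sub>j) - g (c + s e\<^sub>i)\<close>, turns the second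
  difference into \<open>t\<close> times the increment of the \<open>i\<close>-th partial derivative between two points that lie
  within \<open>2 * t\<close> of \<open>c\<close> and differ by \<open>t e\<^sub>j\<close>.  Differentiability of that partial derivative at the
  single point \<open>c\<close> evaluates this increment up to \<open>o(t)\<close>.
\<close>

lemma second_difference_tendsto:
  fixes g :: "real^'d \<Rightarrow> real"
  assumes ev: "\<forall>\<^sub>F x in nhds c. g differentiable (at x)"
    and diff: "partial_deriv i g differentiable (at c)"
  shows "((\<lambda>t. (g (c + t *\<^sub>R axis i 1 + t *\<^sub>R axis j 1) - g (c + t *\<^sub>R axis i 1)
                 - g (c + t *\<^sub>R axis j 1) + g c) / t\<^sup>2)
           \<longlongrightarrow> partial_deriv j (partial_deriv i g) c) (at_right 0)"
    (is "(?q \<longlongrightarrow> _) _")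
proof (rule tendstoI)
  fix e :: real assume "e > 0"
  define h where "h = partial_deriv i g"
  define ei ej :: "real^'d" where "ei = axis i 1" and "ej = axis j 1"
  have norms: "norm ei = 1" "norm ej = 1" by (auto simp: ei_def ej_def)
  obtain L where L: "(h has_derivative L) (at c)"
    using diff unfolding differentiable_def h_def by blast
  have lin: "linear L" by (rule has_derivative_linear[OF L])
  have Lj: "partial_deriv j h c = L ej"
    unfolding ej_def by (rule partial_deriv_eq_frechet[OF L])
  from ev obtain \<rho> where \<rho>: "\<rho> > 0" "\<And>x. dist x c < \<rho> \<Longrightarrow> g differentiable (at x)"
    unfolding eventually_nhds_metric by blast
  from L \<open>e > 0\<close> obtain \<delta> where \<delta>: "\<delta> > 0"
    "\<And>y. norm (y - c) < \<delta> \<Longrightarrow> \<bar>h y - h c - L (y - c)\<bar> \<le> e / 4 * norm (y - c)"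
    unfolding has_derivative_at_alt by (metis real_norm_def zero_less_divide_iff zero_less_numeral)
  \<comment> \<open>The errors at the two points are at most \<open>e / 4 * 2 * t\<close> and \<open>e / 4 * t\<close>, together less than \<open>e * t\<close>.\<close>
  have "dist (?q t) (L ej) < e" if t: "0 < t" "t < min \<rho> \<delta> / 2" for t
  proof -
    define \<phi> where "\<phi> s = g ((c + t *\<^sub>R ej) + s *\<^sub>R ei) - g (c + s *\<^sub>R ei)" for s
    have small: "norm (s *\<^sub>R ei) \<le> t" "norm (t *\<^sub>R ej + s *\<^sub>R ei) \<le> 2 * t" if "0 \<le> s" "s \<le> t" for s
      using that t norm_triangle_ineq[of "t *\<^sub>R ej" "s *\<^sub>R ei"] by (auto simp: norms)
    have d\<phi>: "(\<phi> has_real_derivative h ((c + t *\<^sub>R ej) + s *\<^sub>R ei) - h (c + s *\<^sub>R ei)) (at s)"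
      if "0 \<le> s" "s \<le> t" for s
      unfolding \<phi>_def h_def ei_def
      by (intro DERIV_diff has_real_derivative_partial; fold ei_def; rule \<rho>(2))
        (use small[OF that] t in \<open>auto simp: dist_norm add.assoc\<close>)
    from MVT2[OF t(1) d\<phi>] obtain \<xi> where \<xi>: "0 < \<xi>" "\<xi> < t"
      "\<phi> t - \<phi> 0 = (t - 0) * (h ((c + t *\<^sub>R ej) + \<xi> *\<^sub>R ei) - h (c + \<xi> *\<^sub>R ei))"
      by auto
    have b1: "\<bar>h (c + t *\<^sub>R ej + \<xi> *\<^sub>R ei) - h c - L (t *\<^sub>R ej + \<xi> *\<^sub>R ei)\<bar> \<le> e / 4 * (2 * t)"
    proof -
      have "\<bar>h (c + t *\<^sub>R ej + \<xi> *\<^sub>R ei) - h c - L (t *\<^sub>R ej + \<xi> *\<^sub>R ei)\<bar>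
              \<le> e / 4 * norm (t *\<^sub>R ej + \<xi> *\<^sub>R ei)"
        using \<delta>(2)[of "c + t *\<^sub>R ej + \<xi> *\<^sub>R ei"] small[of \<xi>] \<xi> t by (simp add: add.assoc)
      also have "\<dots> \<le> e / 4 * (2 * t)"
        using small[of \<xi>] \<xi> \<open>e > 0\<close> by (intro mult_left_mono) auto
      finally show ?thesis .
    qed
    have b2: "\<bar>h (c + \<xi> *\<^sub>R ei) - h c - L (\<xi> *\<^sub>R ei)\<bar> \<le> e / 4 * t"
    proof -
      have "\<bar>h (c + \<xi> *\<^sub>R ei) - h c - L (\<xi> *\<^sub>R ei)\<bar> \<le> e / 4 * norm (\<xi> *\<^sub>R ei)"
        using \<delta>(2)[of "c + \<xi> *\<^sub>R ei"] small[of \<xi>] \<xi> t by simp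
      also have "\<dots> \<le> e / 4 * t"
        using small[of \<xi>] \<xi> \<open>e > 0\<close> by (intro mult_left_mono) auto
      finally show ?thesis .
    qed
    let ?D = "h (c + t *\<^sub>R ej + \<xi> *\<^sub>R ei) - h (c + \<xi> *\<^sub>R ei)"
    have "\<bar>?D - t * L ej\<bar> \<le> e / 4 * (3 * t)"
      using b1 b2 unfolding linear_add[OF lin] linear_scale[OF lin] real_scaleR_def by linarith
    also have "\<dots> < e * t" using t \<open>e > 0\<close> by simp
    finally have "\<bar>?D - t * L ej\<bar> < e * t" .
    moreover have "g (c + t *\<^sub>R axis i 1 + t *\<^sub>R axis j 1) - g (c + t *\<^sub>R axis i 1)
        - g (c + t *\<^sub>R axis j 1) + g c = t * ?D"
      using \<xi>(3) unfolding \<phi>_def ei_def ej_def by (simp add: algebra_simps)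
    then have "?q t - L ej = (?D - t * L ej) / t"
      using t(1) by (simp add: power2_eq_square diff_divide_distrib)
    ultimately show ?thesis using t(1) by (simp add: dist_real_def divide_less_eq)
  qed
  then show "\<forall>\<^sub>F t in at_right 0. dist (?q t) (partial_deriv j (partial_deriv i g) c) < e"
    using \<rho>(1) \<delta>(1) unfolding Lj[unfolded h_def] eventually_at_right_field
    by (intro exI[of _ "min \<rho> \<delta> / 2"]) auto
qed

text \<open>Young's theorem: the second difference is symmetric in \<open>i\<close> and \<open>j\<close>, so its two limits agree.\<close>

theorem partial_deriv_commute:
  fixes g :: "real^'d \<Rightarrow> real"
  assumes "\<forall>\<^sub>F x in nhds c. g differentiable (at x)"
    and "partial_deriv i g differentiable (at c)" "partial_deriv j g differentiable (at c)"
  shows "partial_deriv i (partial_deriv j g) c = partial_deriv j (partial_deriv i g) c"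
proof (rule tendsto_unique)
  show "((\<lambda>t. (g (c + t *\<^sub>R axis i 1 + t *\<^sub>R axis j 1) - g (c + t *\<^sub>R axis i 1)
                 - g (c + t *\<^sub>R axis j 1) + g c) / t\<^sup>2)
           \<longlongrightarrow> partial_deriv i (partial_deriv j g) c) (at_right 0)"
    using second_difference_tendsto[OF assms(1,3), of i] by (simp add: add_ac diff_diff_eq)
qed (use second_difference_tendsto[OF assms(1,2)] in auto)

lemma partial_deriv_cong:
  fixes g h :: "real^'d \<Rightarrow> real"
  assumes "\<forall>\<^sub>F x in nhds c. g x = h x"
  shows "partial_deriv i g c = partial_deriv i h c"
proof -
  have "filterlim (\<lambda>t. c + t *\<^sub>R axis i 1) (nhds c) (nhds (0::real))"
    by (rule filterlim_compose[of "\<lambda>x. x"]; (rule filterlim_ident)?)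
      (auto intro!: tendsto_eq_intros filterlim_ident)
  then have "\<forall>\<^sub>F t in nhds (0::real). g (c + t *\<^sub>R axis i 1) = h (c + t *\<^sub>R axis i 1)"
    unfolding filterlim_iff using assms by blast
  then show ?thesis
    unfolding partial_deriv_def by (intro deriv_cong_ev) auto
qed

lemma iter_partial_deriv_swap:
  assumes "times_differentiable_at (Suc (Suc (length ls))) f c"
  shows "iter_partial_deriv (i # j # ls) f c = iter_partial_deriv (j # i # ls) f c"
proof -
  have "\<forall>\<^sub>F x in nhds c. iter_partial_deriv ls f differentiable (at x)"
    using assms unfolding times_differentiable_at.simps(2)
    by (auto elim: eventually_mono)
  moreover have "iter_partial_deriv (k # ls) f differentiable (at c)" for k
    using assms unfolding times_differentiable_at.simps(2) by (metis length_Cons)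
  ultimately show ?thesis
    using partial_deriv_commute[of "iter_partial_deriv ls f" c i j] by simp
qed

text \<open>
  The induction hypothesis is used at all points near \<open>c\<close>: the outermost differentiation sees the
  inner derivative as a germ, so the inner operators may be permuted.  Together with the swap of
  the two outermost operators this generates all permutations.
\<close>

theorem iter_partial_deriv_mset:
  "times_differentiable_at r f c \<Longrightarrow> length js = r \<Longrightarrow> mset js = mset ks \<Longrightarrow>
     iter_partial_deriv js f c = iter_partial_deriv ks f c"
proof (induction r arbitrary: c js ks)
  case (Suc r)
  have same_head: "iter_partial_deriv (i # ls) f c = iter_partial_deriv (i # ms) f c"
    if "length ls = r" "mset ls = mset ms" for i ls ms
  proof -
    have "\<forall>\<^sub>F x in nhds c. iter_partial_deriv ls f x = iter_partial_deriv ms f x"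
      using Suc.prems(1) Suc.IH[OF _ that] by (auto elim: eventually_mono)
    then show ?thesis by (simp add: partial_deriv_cong)
  qed
  obtain i ls where js: "js = i # ls" "length ls = r"
    using Suc.prems(2) by (cases js) auto
  obtain j ms where ks: "ks = j # ms" "length ms = r"
    using Suc.prems(2) mset_eq_length[OF Suc.prems(3)] by (cases ks) auto
  show ?case
  proof (cases "i = j")
    case True
    then show ?thesis using Suc.prems(3) js ks same_head[of ls ms i] by simp
  next
    case False
    have eq: "add_mset i (mset ls) = add_mset j (mset ms)"
      using Suc.prems(3) js ks by simp
    then obtain M where M: "mset ls = add_mset j M" "mset ms = add_mset i M"
      using False by (metis add_eq_conv_ex)
    \<comment> \<open>Bring \<open>j\<close> to the second place, swap it with \<open>i\<close>, and rearrange the rest.\<close>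
    obtain ns where ns: "mset ns = M" using ex_mset by blast
    have len: "Suc (length ns) = r"
      using M(1) js(2) ns by (metis size_add_mset size_mset)
    have "iter_partial_deriv js f c = iter_partial_deriv (i # j # ns) f c"
      unfolding js using M ns js by (intro same_head) auto
    also have "\<dots> = iter_partial_deriv (j # i # ns) f c"
      using Suc.prems(1) len by (intro iter_partial_deriv_swap) simp
    also have "\<dots> = iter_partial_deriv ks f c"
      unfolding ks using M ns len by (intro same_head) auto
    finally show ?thesis .
  qed
qed simp

section \<open>Polarization\<close>

lemma finite_lists_length: "finite {js :: 'a::finite list. length js = r}"
  using finite_lists_length_eq[of "UNIV :: 'a set" r] by simp

text \<open>
  Evaluate the form at the sum of the unit vectors of the coordinates \<open>ks ! i\<close>, \<open>i \<in> S\<close>, for sets \<open>S\<close> of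
  positions.  Expanding the product of sums gives the sum of \<open>b [ks ! \<tau> 0, \<dots>, ks ! \<tau> (r - 1)]\<close> over all maps \<open>\<tau>\<close> from the positions into \<open>S\<close>.
  Inclusion-exclusion over \<open>S\<close> isolates the surjective maps, which are the permutations.
\<close>

theorem sum_permutations_eq_0_if_form_eq_0:
  fixes b :: "'a::finite list \<Rightarrow> real"
  assumes form: "\<And>u :: 'a \<Rightarrow> real. (\<Sum>js | length js = r. prod_list (map u js) * b js) = 0"
    and ks: "length ks = r"
  shows "(\<Sum>\<sigma> | \<sigma> permutes {..<r}. b (permute_list \<sigma> ks)) = 0"
proof -
  let ?I = "{..<r}"
  define F where "F \<tau> = b (map (\<lambda>n. ks ! \<tau> n) [0..<r])" for \<tau> :: "nat \<Rightarrow> nat"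
  define N where "N U = (\<Sum>\<tau> | \<tau> \<in> ?I \<rightarrow>\<^sub>E U \<and> \<tau> ` ?I = U. F \<tau>)" for U
  have fin: "finite (?I \<rightarrow>\<^sub>E S)" if "finite S" for S :: "nat set"
    using that by (simp add: finite_PiE)
  have vanish: "(\<Sum>\<tau>\<in>?I \<rightarrow>\<^sub>E S. F \<tau>) = 0" if S: "finite S" for S
  proof -
    define u where "u j = (\<Sum>i\<in>S. if ks ! i = j then 1 else 0 :: real)" for j
    \<comment> \<open>\<open>u\<close> counts the positions in \<open>S\<close> at which \<open>ks\<close> has the entry \<open>j\<close>.\<close>
    have mono: "prod_list (map u js) = (\<Sum>\<tau>\<in>?I \<rightarrow>\<^sub>E S. if js = map (\<lambda>n. ks ! \<tau> n) [0..<r] then 1 else 0)"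
      if "length js = r" for js
    proof -
      have "prod_list (map u js) = (\<Prod>n\<in>?I. \<Sum>i\<in>S. if ks ! i = js ! n then 1 else 0)"
        using that by (simp add: prod.list_conv_set_nth u_def atLeast0LessThan)
      also have "\<dots> = (\<Sum>\<tau>\<in>?I \<rightarrow>\<^sub>E S. \<Prod>n\<in>?I. if ks ! \<tau> n = js ! n then 1 else 0)"
        using S by (intro prod_sum_PiE) auto
      also have "\<dots> = (\<Sum>\<tau>\<in>?I \<rightarrow>\<^sub>E S. if js = map (\<lambda>n. ks ! \<tau> n) [0..<r] then 1 else 0)"
        using that by (intro sum.cong refl) (auto simp: list_eq_iff_nth_eq)
      finally show ?thesis .
    qed
    have "0 = (\<Sum>js | length js = r. prod_list (map u js) * b js)"
      using form[of u] by simp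
    also have "\<dots> = (\<Sum>js | length js = r. \<Sum>\<tau>\<in>?I \<rightarrow>\<^sub>E S. if js = map (\<lambda>n. ks ! \<tau> n) [0..<r] then b js else 0)"
    proof (rule sum.cong[OF refl])
      fix js :: "'a list" assume "js \<in> {js. length js = r}"
      then show "prod_list (map u js) * b js =
        (\<Sum>\<tau>\<in>?I \<rightarrow>\<^sub>E S. if js = map (\<lambda>n. ks ! \<tau> n) [0..<r] then b js else 0)"
        by (simp only: mono mem_Collect_eq sum_distrib_right) (rule sum.cong; simp)
    qed
    also have "\<dots> = (\<Sum>\<tau>\<in>?I \<rightarrow>\<^sub>E S. F \<tau>)"
      by (subst sum.swap) (simp add: finite_lists_length F_def)
    finally show ?thesis by simp
  qed
  have "(-1) ^ card ?I * N ?I = (\<Sum>T\<in>Pow ?I. (-1) ^ card T * (\<Sum>\<tau>\<in>?I \<rightarrow>\<^sub>E T. F \<tau>))"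
  proof (rule inclusion_exclusion_symmetric)
    fix S :: "nat set" assume S: "finite S"
    have "(\<Sum>\<tau>\<in>?I \<rightarrow>\<^sub>E S. F \<tau>) = (\<Sum>U\<in>Pow S. \<Sum>\<tau> | \<tau> \<in> ?I \<rightarrow>\<^sub>E S \<and> \<tau> ` ?I = U. F \<tau>)"
      using S by (subst sum.group[OF fin[OF S]]) (auto simp: PiE_def)
    also have "\<dots> = (\<Sum>U\<in>Pow S. N U)"
      unfolding N_def by (intro sum.cong refl) (auto simp: PiE_iff)
    finally show "(\<Sum>\<tau>\<in>?I \<rightarrow>\<^sub>E S. F \<tau>) = (\<Sum>U\<in>Pow S. (-1) ^ card U * ((-1) ^ card U * N U))"
      by (simp flip: mult.assoc power_add)
  qed simp
  then have "N ?I = 0"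
    by (simp add: vanish finite_subset)
  \<comment> \<open>The maps counted by \<open>N\<close> are undefined outside the positions; permutations are the identity there.\<close>
  moreover have "(\<Sum>\<sigma> | \<sigma> permutes ?I. b (permute_list \<sigma> ks)) = N ?I"
    unfolding N_def
  proof (rule sum.reindex_bij_witness[where i = "\<lambda>\<tau> n. if n < r then \<tau> n else n"
        and j = "\<lambda>\<sigma>. restrict \<sigma> ?I"])
    fix \<tau> assume \<tau>: "\<tau> \<in> {\<tau> \<in> ?I \<rightarrow>\<^sub>E ?I. \<tau> ` ?I = ?I}"
    then have "inj_on \<tau> ?I" by (auto intro!: eq_card_imp_inj_on)
    then show "(\<lambda>n. if n < r then \<tau> n else n) \<in> {\<sigma>. \<sigma> permutes ?I}"
      using \<tau> by (auto intro!: bij_imp_permutes simp: bij_betw_def inj_on_def image_def)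
    show "restrict (\<lambda>n. if n < r then \<tau> n else n) ?I = \<tau>"
      using \<tau> by (auto simp: PiE_def extensional_def)
  next
    fix \<sigma> assume "\<sigma> \<in> {\<sigma>. \<sigma> permutes ?I}"
    then have \<sigma>: "\<sigma> permutes ?I" by simp
    show "(\<lambda>n. if n < r then restrict \<sigma> ?I n else n) = \<sigma>"
      using permutes_not_in[OF \<sigma>] by auto
    show "restrict \<sigma> ?I \<in> {\<tau> \<in> ?I \<rightarrow>\<^sub>E ?I. \<tau> ` ?I = ?I}"
      using permutes_in_image[OF \<sigma>] permutes_image[OF \<sigma>] by auto
    show "F (restrict \<sigma> ?I) = b (permute_list \<sigma> ks)"
      using ks by (auto simp: F_def permute_list_def intro!: arg_cong[of _ _ b])
  qed
  ultimately show ?thesis by simp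
qed

section \<open>Vectorization and Kronecker products\<close>

text \<open>
  The matrix on the left is block diagonal with \<open>p\<close> copies of \<open>M\<close>, and the blocks of the vector are
  the columns of \<open>A\<close>; so each column is multiplied by \<open>M\<close>.
\<close>

lemma kron_mat_one_mult_vec_of_mat:
  fixes M A :: "'a::comm_semiring_1 mat"
  assumes M: "M \<in> carrier_mat m n" and A: "A \<in> carrier_mat n p"
  shows "kron_mat (1\<^sub>m p) M *\<^sub>v vec_of_mat A = vec_of_mat (M * A)"
proof (rule eq_vecI)
  show "dim_vec (kron_mat (1\<^sub>m p) M *\<^sub>v vec_of_mat A) = dim_vec (vec_of_mat (M * A))"
    using M A by (simp add: kron_mat_def vec_of_mat_def mult.commute)
  fix k assume "k < dim_vec (vec_of_mat (M * A))"
  then have k: "k < m * p" using M A by (simp add: vec_of_mat_def)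
  then have km: "k mod m < m" "k div m < p"
    by (cases "m = 0"; simp add: less_mult_imp_div_less mult.commute)+
  let ?g = "\<lambda>l. kron_mat (1\<^sub>m p) M $$ (k, l) * vec_of_mat A $ l"
  have "(kron_mat (1\<^sub>m p) M *\<^sub>v vec_of_mat A) $ k = (\<Sum>l<p * n. ?g l)"
    using M A k by (simp add: scalar_prod_def kron_mat_def vec_of_mat_def mult.commute
        atLeast0LessThan)
  also have "\<dots> = (\<Sum>q<p. \<Sum>j<n. ?g (q * n + j))"
    by (simp add: sum.atLeastLessThan_shift_0 atLeast0LessThan flip: sum.nat_group)
  also have "\<dots> = (\<Sum>q<p. if q = k div m then (\<Sum>j<n. M $$ (k mod m, j) * A $$ (j, q)) else 0)"
  proof (rule sum.cong[OF refl])
    fix q assume "q \<in> {..<p}"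
    then have q: "q < p" by simp
    have "?g (q * n + j) = (if q = k div m then M $$ (k mod m, j) * A $$ (j, q) else 0)"
      if "j < n" for j
      using that q km k M pair_index_less[OF that q] vec_of_mat_index[OF A that q]
      by (simp add: kron_mat_def mult.commute[of p])
    then show "(\<Sum>j<n. ?g (q * n + j)) =
      (if q = k div m then (\<Sum>j<n. M $$ (k mod m, j) * A $$ (j, q)) else 0)"
      by simp
  qed
  also have "\<dots> = (\<Sum>j<n. M $$ (k mod m, j) * A $$ (j, k div m))"
    using km by simp
  also have "\<dots> = vec_of_mat (M * A) $ k"
    using M A k km by (simp add: vec_of_mat_def scalar_prod_def atLeast0LessThan)
  finally show "(kron_mat (1\<^sub>m p) M *\<^sub>v vec_of_mat A) $ k = vec_of_mat (M * A) $ k" .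
qed

lemma kron_mat_mat_of_row:
  fixes v w :: "'a::times vec"
  shows "kron_mat (mat_of_row v) (mat_of_row w) = mat_of_row (kron_vec v w)"
proof (rule eq_matI)
  fix i j
  assume "i < dim_row (mat_of_row (kron_vec v w))" "j < dim_col (mat_of_row (kron_vec v w))"
  then have ij: "i = 0" "j < dim_vec v * dim_vec w" by (auto simp: kron_vec_def)
  then have "j mod dim_vec w < dim_vec w" "j div dim_vec w < dim_vec v"
    by (cases "dim_vec w = 0"; simp add: less_mult_imp_div_less)+
  with ij show "kron_mat (mat_of_row v) (mat_of_row w) $$ (i, j) =
      mat_of_row (kron_vec v w) $$ (i, j)"
    by (simp add: kron_mat_def kron_vec_def)
qed (auto simp: kron_mat_def kron_vec_def)

lemma kron_mat_pow_mat_of_row: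
  fixes v :: "'a::semiring_1 vec"
  shows "kron_mat_pow (mat_of_row v) r = mat_of_row (kron_vec_pow v r)"
proof (induction r)
  case 0
  show ?case
    by (rule eq_matI) (auto simp: kron_vec_pow_def kron_vec_list_def)
next
  case (Suc r)
  then show ?case
    by (simp add: kron_mat_mat_of_row) (simp add: kron_vec_pow_def kron_vec_list_def)
qed

text \<open>
  For a matrix with a single row, vectorization is transposition.  This makes the row vector the
  instance of \<open>kron_mat_one_mult_vec_of_mat\<close> that evaluates differentials.
\<close>

lemma transpose_mult_eq_vec_of_row_mult:
  fixes A :: "'a::comm_semiring_1 mat"
  assumes "A \<in> carrier_mat n p" "w \<in> carrier_vec n"
  shows "transpose_mat A *\<^sub>v w = vec_of_mat (mat_of_row w * A)"
  using assms by (intro eq_vecI) (auto simp: vec_of_mat_def scalar_prod_def mult.commute)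

section \<open>The symmetrizer as an average over permutations\<close>

lemma sum_power_eq_sum_digit_tuples:
  fixes g :: "nat \<Rightarrow> real"
  shows "(\<Sum>l<d ^ r. g l) = (\<Sum>ns | length ns = r \<and> set ns \<subseteq> {..<d}. g (digit_pos d ns))"
  by (rule sum.reindex_bij_betw[OF digit_pos_bij, symmetric])

lemma symmetrizer_carrier: "symmetrizer d r \<in> carrier_mat (d ^ r) (d ^ r)"
  using is_symmetrizer_symmetrizer by (simp add: is_symmetrizer_def)

lemma symmetrizer_mult_kron_vec_list:
  assumes "length vs = r" "set vs \<subseteq> carrier_vec d"
  shows "fact r \<cdot>\<^sub>v (symmetrizer d r *\<^sub>v kron_vec_list vs) =
    finsum_vec TYPE(real) (d ^ r) (\<lambda>\<sigma>. kron_vec_list (permute_list \<sigma> vs)) {\<sigma>. \<sigma> permutes {..<r}}"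
proof -
  have "\<forall>vs. length vs = r \<and> set vs \<subseteq> carrier_vec d \<longrightarrow>
      fact r \<cdot>\<^sub>v (symmetrizer d r *\<^sub>v kron_vec_list vs) =
      finsum_vec TYPE(real) (d ^ r) (\<lambda>\<sigma>. kron_vec_list (permute_list \<sigma> vs)) {\<sigma>. \<sigma> permutes {..<r}}"
    using is_symmetrizer_symmetrizer[of d r] unfolding is_symmetrizer_def by (rule conjunct2)
  from this[rule_format, OF conjI[OF assms]] show ?thesis .
qed

text \<open>
  The defining equation at a tuple of unit vectors: their Kronecker product is a unit vector, so the
  left-hand side is a column of the symmetrizer.
\<close>

lemma symmetrizer_index:
  assumes ms: "length ms = r" "set ms \<subseteq> {..<d}" and ns: "length ns = r" "set ns \<subseteq> {..<d}"
  shows "fact r * symmetrizer d r $$ (digit_pos d ns, digit_pos d ms) =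
           (\<Sum>\<sigma> | \<sigma> permutes {..<r}. if permute_list \<sigma> ms = ns then 1 else 0)"
proof -
  let ?S = "symmetrizer d r" and ?us = "map (unit_vec d) ms :: real vec list"
  have us: "length ?us = r" "set ?us \<subseteq> carrier_vec d"
    using ms by auto
  have S: "?S \<in> carrier_mat (d ^ r) (d ^ r)"
    by (rule symmetrizer_carrier)
  have lt: "digit_pos d ns < d ^ r" "digit_pos d ms < d ^ r"
    using digit_pos_less[OF ns(2)] digit_pos_less[OF ms(2)] ms(1) ns(1) by simp_all
  have unit: "kron_vec_list (permute_list \<sigma> ?us) = unit_vec (d ^ r) (digit_pos d (permute_list \<sigma> ms))"
    if "\<sigma> permutes {..<r}" for \<sigma>
    using unit_vec_digit_pos[of "permute_list \<sigma> ms" d] that ms by (simp add: permute_list_map)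
  have "fact r * ?S $$ (digit_pos d ns, digit_pos d ms) =
          (fact r \<cdot>\<^sub>v (?S *\<^sub>v kron_vec_list ?us)) $ digit_pos d ns"
    using S lt unit[OF permutes_id] by (simp add: scalar_prod_right_unit)
  also have "\<dots> = (\<Sum>\<sigma> | \<sigma> permutes {..<r}. kron_vec_list (permute_list \<sigma> ?us) $ digit_pos d ns)"
    unfolding symmetrizer_mult_kron_vec_list[OF us] using unit
    by (intro index_finsum_vec[OF _ lt(1)]) (auto simp: finite_permutations)
  also have "\<dots> = (\<Sum>\<sigma> | \<sigma> permutes {..<r}. if permute_list \<sigma> ms = ns then 1 else 0)"
  proof (rule sum.cong[OF refl])
    fix \<sigma> assume "\<sigma> \<in> {\<sigma>. \<sigma> permutes {..<r}}"
    then have \<sigma>: "\<sigma> permutes {..<r}" by simp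
    have p: "length (permute_list \<sigma> ms) = length ns" "set (permute_list \<sigma> ms) \<subseteq> {..<d}"
      using ms ns \<sigma> by auto
    have "digit_pos d (permute_list \<sigma> ms) < d ^ r"
      using digit_pos_less[OF p(2)] p(1) ns by simp
    then show "kron_vec_list (permute_list \<sigma> ?us) $ digit_pos d ns =
        (if permute_list \<sigma> ms = ns then 1 else 0)"
      using digit_pos_inj[OF p ns(2)] lt by (auto simp: unit[OF \<sigma>])
  qed
  finally show ?thesis .
qed

text \<open>
  Row \<open>ns\<close> of the symmetrizer collects the tuples \<open>ms\<close> that \<open>\<sigma>\<close> carries to \<open>ns\<close>; these are obtained from
  \<open>ns\<close> by the inverse permutation, and inversion permutes the summands.
\<close>

lemma symmetrizer_mult_vec_index:
  assumes a: "a \<in> carrier_vec (d ^ r)" and ns: "length ns = r" "set ns \<subseteq> {..<d}"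
  shows "fact r * (symmetrizer d r *\<^sub>v a) $ digit_pos d ns =
           (\<Sum>\<sigma> | \<sigma> permutes {..<r}. a $ digit_pos d (permute_list \<sigma> ns))"
proof -
  let ?P = "{\<sigma>. \<sigma> permutes {..<r}}" and ?T = "{ms. length ms = r \<and> set ms \<subseteq> {..<d}}"
  have S: "symmetrizer d r \<in> carrier_mat (d ^ r) (d ^ r)"
    by (rule symmetrizer_carrier)
  have lt: "digit_pos d ns < d ^ r"
    using digit_pos_less[OF ns(2)] ns(1) by simp
  have T: "finite ?T"
    using finite_lists_length_eq[of "{..<d}" r] by (simp add: conj_commute)
  have "fact r * (symmetrizer d r *\<^sub>v a) $ digit_pos d ns =
          (\<Sum>ms\<in>?T. fact r * symmetrizer d r $$ (digit_pos d ns, digit_pos d ms) * a $ digit_pos d ms)"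
    using S a lt by (simp add: scalar_prod_def sum_distrib_left atLeast0LessThan sum_power_eq_sum_digit_tuples
        mult.assoc)
  also have "\<dots> = (\<Sum>ms\<in>?T. \<Sum>\<sigma>\<in>?P. if permute_list \<sigma> ms = ns then a $ digit_pos d ms else 0)"
  proof (rule sum.cong[OF refl])
    fix ms assume "ms \<in> ?T"
    then have ms: "length ms = r" "set ms \<subseteq> {..<d}" by auto
    show "fact r * symmetrizer d r $$ (digit_pos d ns, digit_pos d ms) * a $ digit_pos d ms =
        (\<Sum>\<sigma>\<in>?P. if permute_list \<sigma> ms = ns then a $ digit_pos d ms else 0)"
      unfolding symmetrizer_index[OF ms ns] sum_distrib_right by (rule sum.cong) auto
  qed
  also have "\<dots> = (\<Sum>\<sigma>\<in>?P. \<Sum>ms\<in>?T. if ms = permute_list (inv_into UNIV \<sigma>) ns then a $ digit_pos d ms else 0)"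
  proof (subst sum.swap, intro sum.cong refl)
    fix \<sigma> ms assume "\<sigma> \<in> ?P" "ms \<in> ?T"
    then have \<sigma>: "\<sigma> permutes {..<r}" and ms: "length ms = r" by auto
    have "permute_list (inv_into UNIV \<sigma>) (permute_list \<sigma> ms) = ms"
      using permute_list_compose[of "inv_into UNIV \<sigma>" ms \<sigma>] permutes_inv[OF \<sigma>] ms
      by (simp add: permutes_inv_o[OF \<sigma>])
    moreover have "permute_list \<sigma> (permute_list (inv_into UNIV \<sigma>) ns) = ns"
      using permute_list_compose[of \<sigma> ns "inv_into UNIV \<sigma>"] \<sigma> ns
      by (simp add: permutes_inv_o[OF \<sigma>])
    ultimately have "permute_list \<sigma> ms = ns \<longleftrightarrow> ms = permute_list (inv_into UNIV \<sigma>) ns"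
      by auto
    then show "(if permute_list \<sigma> ms = ns then a $ digit_pos d ms else 0) =
        (if ms = permute_list (inv_into UNIV \<sigma>) ns then a $ digit_pos d ms else 0)"
      by simp
  qed
  also have "\<dots> = (\<Sum>\<sigma>\<in>?P. a $ digit_pos d (permute_list (inv_into UNIV \<sigma>) ns))"
  proof (rule sum.cong[OF refl])
    fix \<sigma> assume "\<sigma> \<in> ?P"
    then have "permute_list (inv_into UNIV \<sigma>) ns \<in> ?T"
      using ns permutes_inv[of \<sigma> "{..<r}"] by auto
    then show "(\<Sum>ms\<in>?T. if ms = permute_list (inv_into UNIV \<sigma>) ns then a $ digit_pos d ms else 0) =
        a $ digit_pos d (permute_list (inv_into UNIV \<sigma>) ns)"
      using T by simp
  qed
  also have "\<dots> = (\<Sum>\<sigma>\<in>?P. a $ digit_pos d (permute_list \<sigma> ns))"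
    by (rule sum_permutations_inverse[symmetric])
  finally show ?thesis .
qed

section \<open>Differentials and derivative vectors of scalar functions\<close>

lemma kron_vec_pow_carrier:
  assumes "v \<in> carrier_vec d"
  shows "kron_vec_pow v r \<in> carrier_vec (d ^ r)"
proof -
  have "set (replicate r v) \<subseteq> carrier_vec d" using assms by auto
  from kron_vec_list_carrier[OF this] show ?thesis by (simp add: kron_vec_pow_def)
qed

lemma kron_vec_pow_coord_vec_index:
  fixes u :: "real^'d::{finite,linorder}"
  assumes "length js = r"
  shows "kron_vec_pow (coord_vec u) r $ tuple_pos js = prod_list (map (vec_nth u) js)"
proof -
  have "kron_vec_pow (coord_vec u) r $ tuple_pos js = (\<Prod>j<r. coord_vec u $ coord_pos (js ! j))"
    unfolding kron_vec_pow_def tuple_pos_def using assms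
    by (subst kron_vec_list_index) (auto simp: set_replicate_conv_if)
  then show ?thesis
    using assms by (simp add: prod.list_conv_set_nth atLeast0LessThan)
qed

lemma scalar_prod_kron_vec_pow:
  fixes u :: "real^'d::{finite,linorder}"
  shows "a \<bullet> kron_vec_pow (coord_vec u) r =
           (\<Sum>js | length js = r. prod_list (map (vec_nth u) js) * a $ tuple_pos js)"
proof -
  have "a \<bullet> kron_vec_pow (coord_vec u) r =
          (\<Sum>k<CARD('d) ^ r. a $ k * kron_vec_pow (coord_vec u) r $ k)"
    using kron_vec_pow_carrier[OF coord_vec_carrier[of u], of r]
    by (simp add: scalar_prod_def atLeast0LessThan)
  also have "\<dots> = (\<Sum>js | length js = r. a $ tuple_pos js *
                      kron_vec_pow (coord_vec u) r $ tuple_pos (js :: 'd list))"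
    by (rule sum.reindex_bij_betw[OF tuple_pos_bij, symmetric])
  finally show ?thesis
    by (simp add: kron_vec_pow_coord_vec_index mult.commute)
qed

lemma differential_eq_scalar_prod:
  fixes u :: "real^'d::{finite,linorder}"
  shows "differential r g c u = deriv_vec r g c \<bullet> kron_vec_pow (coord_vec u) r"
  by (simp add: scalar_prod_kron_vec_pow differential_def deriv_vec_index)

text \<open>
  By polarization, applied to the difference of the two coefficient vectors, the derivatives and \<open>a\<close>
  have equal sums over the permutations of each tuple.  For the derivatives all \<open>r!\<close> summands are
  equal; for \<open>a\<close> the sum is \<open>r!\<close> times an entry of the symmetrized vector.
\<close>

theorem deriv_vec_eq_symmetrizer_mult:
  fixes g :: "real^'d::{finite,linorder} \<Rightarrow> real"
  assumes diff: "times_differentiable_at r g c" and a: "a \<in> carrier_vec (CARD('d) ^ r)"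
    and eq: "\<And>u. differential r g c u = a \<bullet> kron_vec_pow (coord_vec u) r"
  shows "deriv_vec r g c = symmetrizer CARD('d) r *\<^sub>v a"
proof (rule eq_vecI)
  have S: "symmetrizer CARD('d) r \<in> carrier_mat (CARD('d) ^ r) (CARD('d) ^ r)"
    by (rule symmetrizer_carrier)
  then show "dim_vec (deriv_vec r g c) = dim_vec (symmetrizer CARD('d) r *\<^sub>v a)"
    by (simp add: deriv_vec_def)
  fix k assume "k < dim_vec (symmetrizer CARD('d) r *\<^sub>v a)"
  then have "k \<in> tuple_pos ` {js :: 'd list. length js = r}"
    using S tuple_pos_bij[where 'd = 'd, of r] by (simp add: bij_betw_def)
  then obtain ks :: "'d list" where ks: "length ks = r" "k = tuple_pos ks" by auto
  define b where "b js = iter_partial_deriv js g c - a $ tuple_pos js" for js :: "'d list"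
  have "(\<Sum>js | length js = r. prod_list (map u js) * b js) = 0" for u
    using eq[of "\<chi> i. u i"]
    by (simp add: differential_def scalar_prod_kron_vec_pow b_def right_diff_distrib
        sum_subtractf vec_lambda_inverse)
  then have "(\<Sum>\<sigma> | \<sigma> permutes {..<r}. b (permute_list \<sigma> ks)) = 0"
    using ks by (intro sum_permutations_eq_0_if_form_eq_0)
  then have "(\<Sum>\<sigma> | \<sigma> permutes {..<r}. iter_partial_deriv (permute_list \<sigma> ks) g c) =
             (\<Sum>\<sigma> | \<sigma> permutes {..<r}. a $ tuple_pos (permute_list \<sigma> ks))"
    by (simp add: b_def sum_subtractf)
  moreover have "(\<Sum>\<sigma> | \<sigma> permutes {..<r}. iter_partial_deriv (permute_list \<sigma> ks) g c) =
      (\<Sum>\<sigma> | \<sigma> permutes {..<r}. iter_partial_deriv ks g c)"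
    using ks by (intro sum.cong refl iter_partial_deriv_mset[OF diff]) auto
  moreover have "\<dots> = fact r * iter_partial_deriv ks g c"
    using card_permutations[of "{..<r}" r] by simp
  moreover have "(\<Sum>\<sigma> | \<sigma> permutes {..<r}. a $ tuple_pos (permute_list \<sigma> ks)) =
      (\<Sum>\<sigma> | \<sigma> permutes {..<r}. a $ digit_pos CARD('d) (permute_list \<sigma> (map coord_pos ks)))"
    using ks by (intro sum.cong refl) (simp add: tuple_pos_def permute_list_map)
  moreover have "\<dots> = fact r * (symmetrizer CARD('d) r *\<^sub>v a) $ k"
    unfolding ks(2) tuple_pos_def
    using ks(1) by (intro symmetrizer_mult_vec_index[OF a, symmetric]) auto
  ultimately show "deriv_vec r g c $ k = (symmetrizer CARD('d) r *\<^sub>v a) $ k"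
    using ks by (simp add: deriv_vec_index)
qed

section \<open>Vector-valued functions\<close>

text \<open>
  This is the inverse vectorization of the stacked derivative vector
  (\<open>vec_of_mat_deriv_mat\<close>), written out so that its columns can be read off.
\<close>

definition deriv_mat ::
  "nat \<Rightarrow> (real^'d::{finite,linorder} \<Rightarrow> real^'p::{finite,linorder}) \<Rightarrow>
    real^'d::{finite,linorder} \<Rightarrow> real mat" where
  "deriv_mat r f c = mat (CARD('d) ^ r) CARD('p)
     (\<lambda>(i, k). deriv_vec r (\<lambda>x. vec_nth (f x) (nth_coord k)) c $ i)"

lemma deriv_mat_carrier:
  fixes f :: "real^'d::{finite,linorder} \<Rightarrow> real^'p::{finite,linorder}"
  shows "deriv_mat r f c \<in> carrier_mat (CARD('d) ^ r) CARD('p)"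
  by (simp add: deriv_mat_def)

lemma vec_of_mat_deriv_mat:
  fixes f :: "real^'d::{finite,linorder} \<Rightarrow> real^'p::{finite,linorder}"
  shows "vec_of_mat (deriv_mat r f c) = vec_deriv_vec r f c"
proof (rule eq_vecI)
  fix k assume "k < dim_vec (vec_deriv_vec r f c)"
  then have k: "k < CARD('d) ^ r * CARD('p)" by (simp add: vec_deriv_vec_def mult.commute)
  then have "k div CARD('d) ^ r < CARD('p)"
    by (simp add: less_mult_imp_div_less mult.commute)
  then show "vec_of_mat (deriv_mat r f c) $ k = vec_deriv_vec r f c $ k"
    using k by (simp add: vec_of_mat_def deriv_mat_def vec_deriv_vec_def mult.commute)
qed (simp add: vec_of_mat_def deriv_mat_def vec_deriv_vec_def mult.commute)

lemma col_deriv_mat: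
  fixes f :: "real^'d::{finite,linorder} \<Rightarrow> real^'p::{finite,linorder}"
  assumes "k < CARD('p)"
  shows "col (deriv_mat r f c) k = deriv_vec r (\<lambda>x. vec_nth (f x) (nth_coord k)) c"
  using assms by (intro eq_vecI) (auto simp: deriv_mat_def deriv_vec_def)

lemma coord_vec_differential:
  fixes f :: "real^'d::{finite,linorder} \<Rightarrow> real^'p::{finite,linorder}"
  shows "coord_vec (vec_differential r f c u) =
           transpose_mat (deriv_mat r f c) *\<^sub>v kron_vec_pow (coord_vec u) r"
proof (rule eq_vecI)
  fix k assume "k < dim_vec (transpose_mat (deriv_mat r f c) *\<^sub>v kron_vec_pow (coord_vec u) r)"
  then have k: "k < CARD('p)" by (simp add: deriv_mat_def)
  then show "coord_vec (vec_differential r f c u) $ k =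
      (transpose_mat (deriv_mat r f c) *\<^sub>v kron_vec_pow (coord_vec u) r) $ k"
    using deriv_mat_carrier[of r f c]
    by (simp add: coord_vec_def vec_differential_def differential_eq_scalar_prod col_deriv_mat)
qed (simp add: coord_vec_def deriv_mat_def)

theorem deriv_mat_eq_symmetrizer_mult:
  fixes f :: "real^'d::{finite,linorder} \<Rightarrow> real^'p::{finite,linorder}"
  assumes diff: "vec_times_differentiable_at r f c"
    and A: "A \<in> carrier_mat (CARD('d) ^ r) CARD('p)"
    and eq: "\<And>u. coord_vec (vec_differential r f c u) =
               transpose_mat A *\<^sub>v kron_vec_pow (coord_vec u) r"
  shows "deriv_mat r f c = symmetrizer CARD('d) r * A"
proof (rule mat_col_eqI)
  have S: "symmetrizer CARD('d) r \<in> carrier_mat (CARD('d) ^ r) (CARD('d) ^ r)"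
    by (rule symmetrizer_carrier)
  then show "dim_row (deriv_mat r f c) = dim_row (symmetrizer CARD('d) r * A)"
    and "dim_col (deriv_mat r f c) = dim_col (symmetrizer CARD('d) r * A)"
    using A by (auto simp: deriv_mat_def)
  fix k assume "k < dim_col (symmetrizer CARD('d) r * A)"
  then have k: "k < CARD('p)" using A by simp
  have "deriv_vec r (\<lambda>x. vec_nth (f x) (nth_coord k)) c = symmetrizer CARD('d) r *\<^sub>v col A k"
  proof (rule deriv_vec_eq_symmetrizer_mult)
    show "times_differentiable_at r (\<lambda>x. vec_nth (f x) (nth_coord k)) c"
      using diff by (simp add: vec_times_differentiable_at_def)
    show "col A k \<in> carrier_vec (CARD('d) ^ r)" by (rule carrier_vecI) (simp add: carrier_matD(1)[OF A])
    show "differential r (\<lambda>x. vec_nth (f x) (nth_coord k)) c u =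
        col A k \<bullet> kron_vec_pow (coord_vec u) r" for u
    proof -
      have "differential r (\<lambda>x. vec_nth (f x) (nth_coord k)) c u =
          coord_vec (vec_differential r f c u) $ k"
        using k by (simp add: coord_vec_def vec_differential_def)
      also have "\<dots> = (transpose_mat A *\<^sub>v kron_vec_pow (coord_vec u) r) $ k"
        by (simp only: eq)
      also have "\<dots> = col A k \<bullet> kron_vec_pow (coord_vec u) r"
        using k A by (subst index_mult_mat_vec) auto
      finally show ?thesis .
    qed
  qed
  then show "col (deriv_mat r f c) k = col (symmetrizer CARD('d) r * A) k"
    using k A S by (simp add: col_deriv_mat)
qed

theorem theorem2:
  fixes f :: "real^'d::{finite,linorder} \<Rightarrow> real^'p::{finite,linorder}"
    and c :: "real^'d::{finite,linorder}" and r d p :: nat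
  assumes "d = CARD('d)" and "p = CARD('p)"
    and "r \<ge> 1"
    and "vec_times_differentiable_at r f c"
  shows "(\<forall>u :: real^'d::{finite,linorder}.
            coord_vec (vec_differential r f c u) =
              kron_mat (1\<^sub>m p) (kron_mat_pow (mat_of_row (coord_vec u)) r) *\<^sub>v vec_deriv_vec r f c \<and>
            kron_mat (1\<^sub>m p) (kron_mat_pow (mat_of_row (coord_vec u)) r) *\<^sub>v vec_deriv_vec r f c =
              transpose_mat (mat_of_vec (d ^ r) p (vec_deriv_vec r f c)) *\<^sub>v kron_vec_pow (coord_vec u) r) \<and>
         (\<forall>a \<in> carrier_vec (p * d ^ r).
            (\<forall>u :: real^'d::{finite,linorder}. coord_vec (vec_differential r f c u) =
               transpose_mat (mat_of_vec (d ^ r) p a) *\<^sub>v kron_vec_pow (coord_vec u) r) \<longrightarrow>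
            vec_deriv_vec r f c = kron_mat (1\<^sub>m p) (symmetrizer d r) *\<^sub>v a) \<and>
         (\<forall>A \<in> carrier_mat (d ^ r) p.
            (\<forall>u :: real^'d::{finite,linorder}. coord_vec (vec_differential r f c u) =
               transpose_mat A *\<^sub>v kron_vec_pow (coord_vec u) r) \<longrightarrow>
            vec_deriv_vec r f c = kron_mat (1\<^sub>m p) (symmetrizer d r) *\<^sub>v vec_of_mat A \<and>
            kron_mat (1\<^sub>m p) (symmetrizer d r) *\<^sub>v vec_of_mat A = vec_of_mat (symmetrizer d r * A))"
proof -
  let ?G = "deriv_mat r f c" and ?S = "symmetrizer d r"
  have G: "?G \<in> carrier_mat (d ^ r) p"
    using deriv_mat_carrier[of r f c] assms by simp
  have S: "?S \<in> carrier_mat (d ^ r) (d ^ r)"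
    by (rule symmetrizer_carrier)
  have part1: "coord_vec (vec_differential r f c u) =
      transpose_mat (mat_of_vec (d ^ r) p (vec_deriv_vec r f c)) *\<^sub>v kron_vec_pow (coord_vec u) r"
    "kron_mat (1\<^sub>m p) (kron_mat_pow (mat_of_row (coord_vec u)) r) *\<^sub>v vec_deriv_vec r f c =
      transpose_mat (mat_of_vec (d ^ r) p (vec_deriv_vec r f c)) *\<^sub>v kron_vec_pow (coord_vec u) r"
    for u
  proof -
    let ?w = "kron_vec_pow (coord_vec u) r"
    have w: "?w \<in> carrier_vec (d ^ r)"
      using kron_vec_pow_carrier[OF coord_vec_carrier[of u]] assms by simp
    then have row: "mat_of_row ?w \<in> carrier_mat 1 (d ^ r)" by simp
    have mat: "mat_of_vec (d ^ r) p (vec_deriv_vec r f c) = ?G"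
      using mat_of_vec_vec_of_mat[OF G] by (simp add: vec_of_mat_deriv_mat)
    show "coord_vec (vec_differential r f c u) =
        transpose_mat (mat_of_vec (d ^ r) p (vec_deriv_vec r f c)) *\<^sub>v ?w"
      unfolding mat by (rule coord_vec_differential)
    show "kron_mat (1\<^sub>m p) (kron_mat_pow (mat_of_row (coord_vec u)) r) *\<^sub>v vec_deriv_vec r f c =
        transpose_mat (mat_of_vec (d ^ r) p (vec_deriv_vec r f c)) *\<^sub>v ?w"
      unfolding mat kron_mat_pow_mat_of_row transpose_mult_eq_vec_of_row_mult[OF G w]
      using kron_mat_one_mult_vec_of_mat[OF row G] by (simp add: vec_of_mat_deriv_mat)
  qed
  have part2: "vec_deriv_vec r f c = kron_mat (1\<^sub>m p) ?S *\<^sub>v vec_of_mat A"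
    if "A \<in> carrier_mat (d ^ r) p"
      "\<forall>u. coord_vec (vec_differential r f c u) = transpose_mat A *\<^sub>v kron_vec_pow (coord_vec u) r"
    for A
    using that deriv_mat_eq_symmetrizer_mult[OF assms(4), of A] kron_mat_one_mult_vec_of_mat[OF S that(1)]
    by (simp add: assms(1,2) flip: vec_of_mat_deriv_mat)
  have part3: "vec_deriv_vec r f c = kron_mat (1\<^sub>m p) ?S *\<^sub>v a"
    if "a \<in> carrier_vec (p * d ^ r)" "\<forall>u. coord_vec (vec_differential r f c u) =
      transpose_mat (mat_of_vec (d ^ r) p a) *\<^sub>v kron_vec_pow (coord_vec u) r" for a
  proof -
    have "a \<in> carrier_vec (d ^ r * p)" using that(1) by (simp add: mult.commute)
    from vec_of_mat_mat_of_vec[OF this] part2[OF _ that(2)] show ?thesis by simp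
  qed
  show ?thesis
    using part1 part2 part3 kron_mat_one_mult_vec_of_mat[OF S] by simp
qed

end
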